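(* Let $X$ be a finite connected simplicial complex with vertices $v_1,\dots,v_m$. Then for every $j\ge0$, $$\ddot{\mathrm{H}}^0_j(X)\cong\mathbb{F}^{n_j}_{(j,j+1)},$$ where $n_j$ is the number of $j$-dimensional simplices in $\bigcap_{i=1}^m\overline{St(v_i)}$.
   Context: $\mathbb{F}$ is the field with two elements; $C(X)$ is the simplicial chain complex of $X$ over $\mathbb{F}$. A colouring $\varepsilon\in\mathbb{Z}_2^m$ colours $v_i$ black if $\varepsilon(i)=1$ and white otherwise; $|\varepsilon|$ is the number of black vertices; the weight of a simplex is its number of white vertices. The horizontal differential $\partial_h^\varepsilon$ sends a simplex $\sigma$ to the sum of its faces $\sigma\setminus\{v\}$ over black vertices $v\in\sigma$; $\mathrm{H}^h(X,\varepsilon)$ is the homology of $(C(X),\partial_h^\varepsilon)$, bigraded by (dimension, weight). For colourings $\varepsilon,\varepsilon'$ differing only at index $i$, with $\varepsilon(i)=0,\varepsilon'(i)=1$, the map $d_{\varepsilon\to\varepsilon'}:\mathrm{H}^h(X,\varepsilon)\to\mathrm{H}^h(X,\varepsilon')$ sends the class of a cycle $x$ (a sum of simplices) to the class of the sum of those simplices of $x$ not containing $v_i$. The \"uber complex is $\ddot{C}^j(X)=\bigoplus_{|\varepsilon|=j}\mathrm{H}^h(X,\varepsilon)$ with differential $d^j$ the sum of all $d_{\varepsilon\to\varepsilon'}$ with $|\varepsilon|=j$; its homology is the \"uberhomology $\ddot{\mathrm{H}}^j(X)$, triply graded, with $\ddot{\mathrm{H}}^j_i(X,k)$ the part in homological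 degree $j$, simplex dimension $i$ and weight $k$, and $\ddot{\mathrm{H}}^j_i(X)=\bigoplus_k\ddot{\mathrm{H}}^j_i(X,k)$. $\mathbb{F}^n_{(a,b)}$ is an $n$-dimensional space concentrated in (dimension, weight) $=(a,b)$. The closed star $\overline{St(v)}$ is the subcomplex of all simplices containing $v$ together with their faces. *)

theory Defs
  imports "HOL-Algebra.AbelCoset" "HOL-Algebra.Module" "HOL-Library.Z2" "HOL-Library.FuncSet"
begin

text \<open>
  The scalars are the elements of the field \<^typ>\<open>bit\<close>. A bigraded vector space is a module record
  together with its subspaces of homogeneous elements of each bidegree (dimension, weight).
  The ring multiplication fields that HOL-Algebra's module records inherit are irrelevant and left
  \<^const>\<open>undefined\<close>.
\<close>

record 'b bigraded = "(bit, 'b) module" +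
  part :: "nat \<times> nat \<Rightarrow> 'b set"

text \<open>The space with basis \<open>S\<close> (for finite \<open>S\<close>), the basis element \<open>s\<close> having bidegree \<open>deg s\<close>.\<close>

definition free_bigraded :: "'s set \<Rightarrow> ('s \<Rightarrow> nat \<times> nat) \<Rightarrow> ('s \<Rightarrow> bit) bigraded" where
  "free_bigraded S deg =
    \<lparr>carrier = {x. \<forall>s. s \<notin> S \<longrightarrow> x s = 0},
     mult = undefined, one = undefined,
     zero = (\<lambda>_. 0), add = (\<lambda>x y s. x s + y s),
     smult = (\<lambda>a x s. a * x s),
     part = (\<lambda>d. {x. (\<forall>s. s \<notin> S \<longrightarrow> x s = 0) \<and> (\<forall>s. x s \<noteq> 0 \<longrightarrow> deg s = d)})\<rparr>"

text \<open>The quotient \<open>Z / B\<close> of subspaces \<open>B \<subseteq> Z\<close> of \<open>M\<close>; a class is homogeneous of bidegree \<open>d\<close>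
  if it is represented by an element of \<open>Z\<close> that is.\<close>

definition subquotient :: "'b bigraded \<Rightarrow> 'b set \<Rightarrow> 'b set \<Rightarrow> 'b set bigraded" where
  "subquotient M Z B =
    \<lparr>carrier = a_rcosets\<^bsub>M\<lparr>carrier := Z\<rparr>\<^esub> B,
     mult = undefined, one = undefined,
     zero = B, add = (<+>\<^bsub>M\<^esub>),
     smult = (\<lambda>a c. \<Union>x\<in>c. B +>\<^bsub>M\<^esub> (a \<odot>\<^bsub>M\<^esub> x)),
     part = (\<lambda>d. {B +>\<^bsub>M\<^esub> x | x. x \<in> Z \<inter> part M d})\<rparr>"

text \<open>For finite \<open>I\<close> only, so that the direct sum is the product.\<close>

definition direct_sum :: "'i set \<Rightarrow> ('i \<Rightarrow> 'b bigraded) \<Rightarrow> ('i \<Rightarrow> 'b) bigraded" where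
  "direct_sum I M =
    \<lparr>carrier = (\<Pi>\<^sub>E i\<in>I. carrier (M i)),
     mult = undefined, one = undefined,
     zero = (\<lambda>i\<in>I. \<zero>\<^bsub>M i\<^esub>), add = (\<lambda>f g. \<lambda>i\<in>I. f i \<oplus>\<^bsub>M i\<^esub> g i),
     smult = (\<lambda>a f. \<lambda>i\<in>I. a \<odot>\<^bsub>M i\<^esub> f i),
     part = (\<lambda>d. \<Pi>\<^sub>E i\<in>I. part (M i) d)\<rparr>"

text \<open>The internal direct sum, over all weights \<open>k\<close>, of the parts of bidegree \<open>(i, k)\<close>.\<close>

definition dim_component :: "'b bigraded \<Rightarrow> nat \<Rightarrow> 'b bigraded" where
  "dim_component M i =
    M\<lparr>carrier := {finsum M c K | c K. finite K \<and> (\<forall>k\<in>K. c k \<in> part M (i, k))},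
      part := (\<lambda>(i', k). if i' = i then part M (i, k) else {\<zero>\<^bsub>M\<^esub>})\<rparr>"

definition concentrated :: "nat \<Rightarrow> nat \<times> nat \<Rightarrow> (nat \<Rightarrow> bit) bigraded" where
  "concentrated n d = free_bigraded {..<n} (\<lambda>_. d)"

definition bigraded_iso :: "'b bigraded \<Rightarrow> 'c bigraded \<Rightarrow> bool" where
  "bigraded_iso M N \<longleftrightarrow>
    (\<exists>h \<in> iso (add_monoid M) (add_monoid N).
      (\<forall>a. \<forall>x\<in>carrier M. h (a \<odot>\<^bsub>M\<^esub> x) = a \<odot>\<^bsub>N\<^esub> h x) \<and>
      (\<forall>d. h ` part M d = part N d))"

text \<open>Simplices are nonempty; the vertices of \<open>X\<close> are the elements of \<open>\<Union>X\<close>.\<close>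

definition simplicial_complex :: "'a set set \<Rightarrow> bool" where
  "simplicial_complex X \<longleftrightarrow>
    (\<forall>\<sigma>\<in>X. finite \<sigma> \<and> \<sigma> \<noteq> {} \<and> (\<forall>\<tau>. \<tau> \<subseteq> \<sigma> \<and> \<tau> \<noteq> {} \<longrightarrow> \<tau> \<in> X))"

definition connected_complex :: "'a set set \<Rightarrow> bool" where
  "connected_complex X \<longleftrightarrow> (\<forall>u\<in>\<Union>X. \<forall>w\<in>\<Union>X. (u, w) \<in> {(a, b). {a, b} \<in> X}\<^sup>*)"

definition closed_star :: "'a set set \<Rightarrow> 'a \<Rightarrow> 'a set set" where
  "closed_star X u = {\<tau>\<in>X. \<exists>\<sigma>\<in>X. u \<in> \<sigma> \<and> \<tau> \<subseteq> \<sigma>}"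

type_synonym colouring = "nat \<Rightarrow> bit"

definition colourings :: "nat \<Rightarrow> nat \<Rightarrow> colouring set" where
  "colourings m j = {\<epsilon> \<in> {1..m} \<rightarrow>\<^sub>E UNIV. card {i\<in>{1..m}. \<epsilon> i = 1} = j}"

definition black :: "(nat \<Rightarrow> 'a) \<Rightarrow> nat \<Rightarrow> colouring \<Rightarrow> 'a set" where
  "black v m \<epsilon> = v ` {i\<in>{1..m}. \<epsilon> i = 1}"

text \<open>A chain is its coefficient function. Removing black vertices from \<open>\<sigma>\<close> keeps the white ones,
  so the weight is preserved by the horizontal differential.\<close>

definition chains :: "'a set set \<Rightarrow> (nat \<Rightarrow> 'a) \<Rightarrow> nat \<Rightarrow> colouring \<Rightarrow> ('a set \<Rightarrow> bit) bigraded" where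
  "chains X v m \<epsilon> = free_bigraded X (\<lambda>\<sigma>. (card \<sigma> - 1, card (\<sigma> - black v m \<epsilon>)))"

definition hdiff ::
  "'a set set \<Rightarrow> (nat \<Rightarrow> 'a) \<Rightarrow> nat \<Rightarrow> colouring \<Rightarrow> ('a set \<Rightarrow> bit) \<Rightarrow> ('a set \<Rightarrow> bit)" where
  "hdiff X v m \<epsilon> x =
    (\<lambda>\<tau>. \<Sum>\<sigma>\<in>X. x \<sigma> *
      (\<Sum>w \<in> {w \<in> \<sigma> \<inter> black v m \<epsilon>. \<sigma> - {w} \<noteq> {}}. if \<sigma> - {w} = \<tau> then 1 else 0))"

definition hboundaries ::
  "'a set set \<Rightarrow> (nat \<Rightarrow> 'a) \<Rightarrow> nat \<Rightarrow> colouring \<Rightarrow> ('a set \<Rightarrow> bit) set" where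
  "hboundaries X v m \<epsilon> = hdiff X v m \<epsilon> ` carrier (chains X v m \<epsilon>)"

definition hhomology ::
  "'a set set \<Rightarrow> (nat \<Rightarrow> 'a) \<Rightarrow> nat \<Rightarrow> colouring \<Rightarrow> ('a set \<Rightarrow> bit) set bigraded" where
  "hhomology X v m \<epsilon> =
    subquotient (chains X v m \<epsilon>)
      (a_kernel (chains X v m \<epsilon>) (chains X v m \<epsilon>) (hdiff X v m \<epsilon>))
      (hboundaries X v m \<epsilon>)"

text \<open>The map from the colouring \<open>\<epsilon>\<close> with \<open>\<epsilon> i = 0\<close> to \<open>\<epsilon>(i := 1)\<close>. The result does not depend
  on the representative \<open>x\<close> of the class \<open>c\<close>, so the union is over copies of one coset.\<close>

definition edge_map ::
  "'a set set \<Rightarrow> (nat \<Rightarrow> 'a) \<Rightarrow> nat \<Rightarrow> colouring \<Rightarrow> nat \<Rightarrow> ('a set \<Rightarrow> bit) set \<Rightarrow> ('a set \<Rightarrow> bit) set" where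
  "edge_map X v m \<epsilon> i c =
    (\<Union>x\<in>c. hboundaries X v m (\<epsilon>(i := 1)) +>\<^bsub>chains X v m (\<epsilon>(i := 1))\<^esub>
      (\<lambda>\<sigma>. if v i \<in> \<sigma> then 0 else x \<sigma>))"

definition uber_chains ::
  "'a set set \<Rightarrow> (nat \<Rightarrow> 'a) \<Rightarrow> nat \<Rightarrow> nat \<Rightarrow> (colouring \<Rightarrow> ('a set \<Rightarrow> bit) set) bigraded" where
  "uber_chains X v m j = direct_sum (colourings m j) (hhomology X v m)"

text \<open>The edges into \<open>\<epsilon>'\<close> start at the colourings \<open>\<epsilon>'(i := 0)\<close>, for the indices \<open>i\<close> with \<open>\<epsilon>' i = 1\<close>.\<close>

definition uber_diff ::
  "'a set set \<Rightarrow> (nat \<Rightarrow> 'a) \<Rightarrow> nat \<Rightarrow> nat \<Rightarrow>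
    (colouring \<Rightarrow> ('a set \<Rightarrow> bit) set) \<Rightarrow> (colouring \<Rightarrow> ('a set \<Rightarrow> bit) set)" where
  "uber_diff X v m j f =
    (\<lambda>\<epsilon>'\<in>colourings m (Suc j).
      \<Oplus>\<^bsub>hhomology X v m \<epsilon>'\<^esub> i \<in> {i\<in>{1..m}. \<epsilon>' i = 1}.
        edge_map X v m (\<epsilon>'(i := 0)) i (f (\<epsilon>'(i := 0))))"

definition uber_boundaries ::
  "'a set set \<Rightarrow> (nat \<Rightarrow> 'a) \<Rightarrow> nat \<Rightarrow> nat \<Rightarrow> (colouring \<Rightarrow> ('a set \<Rightarrow> bit) set) set" where
  "uber_boundaries X v m j =
    (case j of
       0 \<Rightarrow> {\<zero>\<^bsub>uber_chains X v m 0\<^esub>}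
     | Suc l \<Rightarrow> uber_diff X v m l ` carrier (uber_chains X v m l))"

definition uber_homology ::
  "'a set set \<Rightarrow> (nat \<Rightarrow> 'a) \<Rightarrow> nat \<Rightarrow> nat \<Rightarrow> (colouring \<Rightarrow> ('a set \<Rightarrow> bit) set) set bigraded" where
  "uber_homology X v m j =
    subquotient (uber_chains X v m j)
      (a_kernel (uber_chains X v m j) (uber_chains X v m (Suc j)) (uber_diff X v m j))
      (uber_boundaries X v m j)"

end

theory Submission
  imports Defs
begin

text \<open>
  In the all-white colouring the horizontal differential vanishes, so the degree 0 term of the
  complex is the chain complex itself, each simplex having weight equal to its number of vertices.
  If only \<open>v i\<close> is black, the horizontal boundaries are spanned by the simplices \<open>\<tau>\<close> not containing
  \<open>v i\<close> for which \<open>insert (v i) \<tau>\<close> is a simplex. Hence a chain is killed by the \<open>i\<close>-th edge map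
  iff each of its simplices lies in the closed star of \<open>v i\<close>, and the kernel of the differential is
  spanned by the simplices in the intersection of all closed stars.
\<close>

section \<open>Isomorphisms of bigraded spaces and the constructions they pass through\<close>

text \<open>Unlike \<open>bigraded_iso\<close>, this names the map, so that it can be composed and
  restricted. Neither record is assumed to satisfy any algebraic laws, which is why preservation of
  zero is a separate conjunct.\<close>

definition is_bigraded_iso :: "('b \<Rightarrow> 'c) \<Rightarrow> 'b bigraded \<Rightarrow> 'c bigraded \<Rightarrow> bool" where
  "is_bigraded_iso T N M \<longleftrightarrow>
    bij_betw T (carrier N) (carrier M) \<and>
    T \<zero>\<^bsub>N\<^esub> = \<zero>\<^bsub>M\<^esub> \<and>
    (\<forall>x\<in>carrier N. \<forall>y\<in>carrier N. T (x \<oplus>\<^bsub>N\<^esub> y) = T x \<oplus>\<^bsub>M\<^esub> T y) \<and>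
    (\<forall>a. \<forall>x\<in>carrier N. T (a \<odot>\<^bsub>N\<^esub> x) = a \<odot>\<^bsub>M\<^esub> T x) \<and>
    (\<forall>d. T ` part N d = part M d)"

text \<open>Homogeneity is inherited from the ambient space, in agreement with the set
  \<open>Z \<inter> part M d\<close> in \<open>subquotient\<close>.\<close>

definition sub_bigraded :: "'b bigraded \<Rightarrow> 'b set \<Rightarrow> 'b bigraded" where
  "sub_bigraded M Z = M\<lparr>carrier := Z, part := \<lambda>d. Z \<inter> part M d\<rparr>"

lemma is_bigraded_isoD:
  assumes "is_bigraded_iso T N M"
  shows "bij_betw T (carrier N) (carrier M)" "T \<zero>\<^bsub>N\<^esub> = \<zero>\<^bsub>M\<^esub>"
    "\<And>x y. x \<in> carrier N \<Longrightarrow> y \<in> carrier N \<Longrightarrow> T (x \<oplus>\<^bsub>N\<^esub> y) = T x \<oplus>\<^bsub>M\<^esub> T y"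
    "\<And>a x. x \<in> carrier N \<Longrightarrow> T (a \<odot>\<^bsub>N\<^esub> x) = a \<odot>\<^bsub>M\<^esub> T x"
    "\<And>d. T ` part N d = part M d"
    "\<And>x. x \<in> carrier N \<Longrightarrow> T x \<in> carrier M"
  using assms unfolding is_bigraded_iso_def
  by (auto simp del: split_paired_All dest: bij_betwE)

lemma is_bigraded_iso_comp:
  assumes "is_bigraded_iso T N M" and "is_bigraded_iso U M L"
  shows "is_bigraded_iso (U \<circ> T) N L"
proof -
  note T = is_bigraded_isoD[OF assms(1)] and U = is_bigraded_isoD[OF assms(2)]
  have "(U \<circ> T) ` part N d = part L d" for d
    by (simp only: image_comp[symmetric] T(5) U(5))
  then show ?thesis
    unfolding is_bigraded_iso_def using bij_betw_trans[OF T(1) U(1)] T(2-4,6) U(2-4) by auto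
qed

text \<open>The explicit maps below lead from free spaces to homology, whereas the theorem is stated
  in the opposite direction. Closure is required of \<open>N\<close> alone: every element of
  \<open>M\<close> is some \<open>T x\<close>, and the operations can then be carried out in
  \<open>N\<close>.\<close>

lemma bigraded_iso_inverse:
  assumes iso: "is_bigraded_iso T N M" and part: "\<And>d. part N d \<subseteq> carrier N"
    and add: "\<And>x y. x \<in> carrier N \<Longrightarrow> y \<in> carrier N \<Longrightarrow> x \<oplus>\<^bsub>N\<^esub> y \<in> carrier N"
    and smult: "\<And>a x. x \<in> carrier N \<Longrightarrow> a \<odot>\<^bsub>N\<^esub> x \<in> carrier N"
  shows "bigraded_iso M N"
proof -
  note T = is_bigraded_isoD[OF iso]
  define h where "h = inv_into (carrier N) T"
  have inj: "inj_on T (carrier N)" and im: "T ` carrier N = carrier M"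
    using T(1) by (auto simp: bij_betw_def)
  have hT: "h (T x) = x" if "x \<in> carrier N" for x
    using inj that by (simp add: h_def)
  have bij: "bij_betw h (carrier M) (carrier N)"
    unfolding h_def by (rule bij_betw_inv_into[OF T(1)])
  have "h (x \<oplus>\<^bsub>M\<^esub> y) = h x \<oplus>\<^bsub>N\<^esub> h y" if "x \<in> carrier M" "y \<in> carrier M" for x y
    using that unfolding im[symmetric] by (auto simp: T(3)[symmetric] hT add)
  moreover have "h (a \<odot>\<^bsub>M\<^esub> x) = a \<odot>\<^bsub>N\<^esub> h x" if "x \<in> carrier M" for a x
    using that unfolding im[symmetric] by (auto simp: T(4)[symmetric] hT smult)
  moreover have "h ` part M d = part N d" for d
    unfolding T(5)[symmetric] image_image using part[of d] hT by force
  ultimately show ?thesis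
    unfolding bigraded_iso_def using bij bij_betwE[OF bij]
    by (intro bexI[of _ h]) (auto simp: iso_def hom_def)
qed

lemma is_bigraded_iso_sub_bigraded:
  assumes iso: "is_bigraded_iso T N M" and Z: "Z \<subseteq> carrier N" and part: "\<And>d. part N d \<subseteq> carrier N"
  shows "is_bigraded_iso T (sub_bigraded N Z) (sub_bigraded M (T ` Z))"
proof -
  note T = is_bigraded_isoD[OF iso]
  have inj: "inj_on T (carrier N)" using T(1) by (auto simp: bij_betw_def)
  have "T ` (Z \<inter> part N d) = T ` Z \<inter> part M d" for d
    using inj_on_image_Int[OF inj Z part] T(5) by simp
  moreover have "bij_betw T Z (T ` Z)" using inj_on_subset[OF inj Z] by (simp add: bij_betw_def)
  ultimately show ?thesis
    using T(2) T(3,4)[OF subsetD[OF Z]] Z by (auto simp: is_bigraded_iso_def sub_bigraded_def)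
qed

text \<open>Each law for \<open>M\<close> is pulled back along the surjection \<open>T\<close>. This
  makes \<open>finsum\<close> usable in uberhomology without a separate proof that the latter is a
  group.\<close>

lemma abelian_monoid_transfer:
  assumes N: "abelian_monoid N" and iso: "is_bigraded_iso T N M"
  shows "abelian_monoid M"
proof -
  note T = is_bigraded_isoD[OF iso]
  interpret abelian_monoid N by fact
  have im: "carrier M = T ` carrier N" using T(1) by (auto simp: bij_betw_def)
  show ?thesis
    by (rule abelian_monoidI)
      (auto simp: im T(2)[symmetric] T(3)[symmetric] a_ac)
qed

lemma finsum_transfer:
  assumes N: "abelian_monoid N" and iso: "is_bigraded_iso T N M"
    and "finite K" "c \<in> K \<rightarrow> carrier N"
  shows "finsum M (\<lambda>k. T (c k)) K = T (finsum N c K)"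
proof -
  note T = is_bigraded_isoD[OF iso]
  interpret N: abelian_monoid N by fact
  interpret M: abelian_monoid M using N iso by (rule abelian_monoid_transfer)
  show ?thesis using assms(3,4)
  proof (induction K)
    case empty
    then show ?case by (simp add: T(2))
  next
    case (insert k K)
    then have "(\<lambda>k. T (c k)) \<in> K \<rightarrow> carrier M" "T (c k) \<in> carrier M"
      "finsum N c K \<in> carrier N"
      using T(6) by auto
    with insert show ?case by (simp add: T(3))
  qed
qed

text \<open>Elements of the component are finite sums of homogeneous elements; \<open>T\<close>
  commutes with such sums and matches the homogeneous parts.\<close>

lemma is_bigraded_iso_dim_component:
  assumes N: "abelian_monoid N" and iso: "is_bigraded_iso T N M"
    and part: "\<And>d. part N d \<subseteq> carrier N"
  shows "is_bigraded_iso T (dim_component N i) (dim_component M i)"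
proof -
  note T = is_bigraded_isoD[OF iso]
  interpret N: abelian_monoid N by fact
  interpret M: abelian_monoid M using N iso by (rule abelian_monoid_transfer)
  define A where "A = {finsum N c K | c K. finite K \<and> (\<forall>k\<in>K. c k \<in> part N (i, k))}"
  define B where "B = {finsum M c K | c K. finite K \<and> (\<forall>k\<in>K. c k \<in> part M (i, k))}"
  have A: "A \<subseteq> carrier N"
    using part by (fastforce simp: A_def intro!: N.finsum_closed)
  have "T ` A \<subseteq> B"
  proof safe
    fix x assume "x \<in> A"
    then obtain c K where x: "x = finsum N c K" "finite K" "\<forall>k\<in>K. c k \<in> part N (i, k)"
      by (auto simp: A_def)
    then have "c \<in> K \<rightarrow> carrier N" using part by blast
    with x have "T x = finsum M (\<lambda>k. T (c k)) K"
      using finsum_transfer[OF N iso] by metis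
    moreover have "\<forall>k\<in>K. T (c k) \<in> part M (i, k)" using x(3) T(5) by blast
    ultimately show "T x \<in> B"
      unfolding B_def using x(2) by blast
  qed
  moreover have "B \<subseteq> T ` A"
  proof
    fix y assume "y \<in> B"
    then obtain c K where y: "y = finsum M c K" "finite K" "\<forall>k\<in>K. c k \<in> part M (i, k)"
      by (auto simp: B_def)
    \<comment> \<open>The summands are lifted one at a time, each to a homogeneous element of the
      same bidegree, so that the lifted sum again has the required shape.\<close>
    then have "\<forall>k\<in>K. \<exists>x. x \<in> part N (i, k) \<and> c k = T x"
      using T(5) by blast
    then obtain c' where c': "\<forall>k\<in>K. c' k \<in> part N (i, k) \<and> c k = T (c' k)"
      by metis
    then have c'_closed: "c' \<in> K \<rightarrow> carrier N" using part by blast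
    have "y = finsum M (\<lambda>k. T (c' k)) K"
      unfolding y(1) using c' c'_closed T(6) by (intro M.finsum_cong') auto
    also have "\<dots> = T (finsum N c' K)"
      by (rule finsum_transfer[OF N iso y(2) c'_closed])
    finally show "y \<in> T ` A" unfolding A_def using y(2) c' by blast
  qed
  ultimately have im: "T ` A = B" by blast
  have "inj_on T A" using T(1) A by (auto simp: bij_betw_def intro: inj_on_subset)
  with im A T(2-5) show ?thesis
    unfolding is_bigraded_iso_def dim_component_def A_def[symmetric] B_def[symmetric]
    by (auto simp: bij_betw_def subset_iff)
qed

lemma a_r_coset_singleton: "{b} +>\<^bsub>M\<^esub> x = {b \<oplus>\<^bsub>M\<^esub> x}"
  by (simp add: a_r_coset_def r_coset_def)

text \<open>Cosets of the zero subspace are singletons. This is used twice: for the horizontal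
  homology of the all-white colouring, which has no nonzero boundaries, and for uberhomology in
  degree 0, which no differential enters.\<close>

lemma is_bigraded_iso_subquotient_zero:
  assumes M: "abelian_monoid M" and Z: "Z \<subseteq> carrier M"
    and smult: "\<And>a x. x \<in> Z \<Longrightarrow> a \<odot>\<^bsub>M\<^esub> x \<in> carrier M"
  shows "is_bigraded_iso (\<lambda>x. {x}) (sub_bigraded M Z) (subquotient M Z {\<zero>\<^bsub>M\<^esub>})"
proof -
  interpret abelian_monoid M by fact
  have Zc: "x \<in> carrier M" if "x \<in> Z" for x using that Z by blast
  have coset: "{\<zero>\<^bsub>M\<^esub>} +>\<^bsub>M\<^esub> x = {x}" if "x \<in> carrier M" for x
    using that by (simp add: a_r_coset_singleton)
  have "{{\<zero>\<^bsub>M\<^esub>} +>\<^bsub>M\<^esub> x | x. x \<in> Z \<inter> P} = (\<lambda>x. {x}) ` (Z \<inter> P)" for P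
    using coset Zc by (auto simp: image_iff)
  moreover have "a_rcosets\<^bsub>M\<lparr>carrier := Z\<rparr>\<^esub> {\<zero>\<^bsub>M\<^esub>} = (\<lambda>x. {x}) ` Z"
    using Zc by (auto simp: A_RCOSETS_def RCOSETS_def r_coset_def)
  ultimately show ?thesis
    using smult Zc
    by (auto simp: is_bigraded_iso_def sub_bigraded_def subquotient_def bij_betw_def
        set_add_def set_mult_def coset)
qed

lemma is_bigraded_iso_direct_sum_singleton:
  fixes M :: "'i \<Rightarrow> 'b bigraded"
  shows "is_bigraded_iso (\<lambda>x. \<lambda>j\<in>{i}. x) (M i) (direct_sum {i} M)"
proof -
  have im: "(\<lambda>x. \<lambda>j\<in>{i}. x) ` A = (\<Pi>\<^sub>E j\<in>{i}. A)" for A :: "'b set"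
  proof safe
    fix f assume "f \<in> (\<Pi>\<^sub>E j\<in>{i}. A)"
    then have "f = (\<lambda>j\<in>{i}. f i)" "f i \<in> A"
      by (auto simp: PiE_iff extensional_def)
    then show "f \<in> (\<lambda>x. \<lambda>j\<in>{i}. x) ` A" by blast
  qed (auto split: if_splits)
  have PiE: "(\<Pi>\<^sub>E j\<in>{i}. P j) = (\<Pi>\<^sub>E j\<in>{i}. P i)" for P :: "'i \<Rightarrow> 'b set"
    by (rule PiE_cong) simp
  have "inj_on (\<lambda>x. \<lambda>j\<in>{i}. x) A" for A :: "'b set"
    by (rule inj_onI) (metis restrict_apply' singletonI)
  then show ?thesis
    unfolding is_bigraded_iso_def direct_sum_def
    by (auto simp: im bij_betw_def PiE[of "\<lambda>j. carrier (M j)"] PiE[of "\<lambda>j. part (M j) _"]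
        fun_eq_iff)
qed

section \<open>Free bigraded spaces\<close>

lemma comm_group_free_bigraded: "comm_group (add_monoid (free_bigraded S deg))"
proof (rule comm_groupI, goal_cases)
  \<comment> \<open>This is the goal about inverses: over \<open>bit\<close> every element is its
    own negative.\<close>
  case (6 x)
  then show ?case by (intro bexI[of _ x]) (auto simp: free_bigraded_def)
qed (auto simp: free_bigraded_def add.assoc add.commute simp del: add_bit_eq_xor)

lemma abelian_monoid_free_bigraded: "abelian_monoid (free_bigraded S deg)"
  using comm_group_free_bigraded[of S deg]
  by (simp add: abelian_monoid_def comm_group_def)

lemma part_free_bigraded: "part (free_bigraded S deg) d \<subseteq> carrier (free_bigraded S deg)"
  by (auto simp: free_bigraded_def)

lemma sub_bigraded_free_bigraded:
  "S' \<subseteq> S \<Longrightarrow>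
    sub_bigraded (free_bigraded S deg) {x. \<forall>s. s \<notin> S' \<longrightarrow> x s = 0} = free_bigraded S' deg"
  by (auto simp: sub_bigraded_def free_bigraded_def fun_eq_iff)

lemma finsum_free_bigraded:
  assumes "finite K" "\<And>k. k \<in> K \<Longrightarrow> c k \<in> carrier (free_bigraded S deg)"
  shows "finsum (free_bigraded S deg) c K = (\<lambda>s. \<Sum>k\<in>K. c k s)"
proof -
  interpret abelian_monoid "free_bigraded S deg" by (rule abelian_monoid_free_bigraded)
  show ?thesis using assms
  proof (induction K)
    case empty
    show ?case by (subst finsum_empty) (simp add: free_bigraded_def)
  next
    case (insert k K)
    then have "finsum (free_bigraded S deg) c (insert k K) =
        c k \<oplus>\<^bsub>free_bigraded S deg\<^esub> finsum (free_bigraded S deg) c K"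
      by (intro finsum_insert) auto
    with insert show ?case by (simp add: free_bigraded_def)
  qed
qed

text \<open>A function supported in dimension \<open>i\<close> is the sum of its slices of fixed
  weight, and finiteness of \<open>S\<close> leaves only finitely many weights.\<close>

lemma dim_component_free_bigraded:
  assumes "finite S"
  shows "dim_component (free_bigraded S deg) i = free_bigraded {s\<in>S. fst (deg s) = i} deg"
proof -
  let ?F = "free_bigraded S deg" and ?S = "{s\<in>S. fst (deg s) = i}"
  have "{finsum ?F c K | c K. finite K \<and> (\<forall>k\<in>K. c k \<in> part ?F (i, k))} =
      {x. \<forall>s. s \<notin> ?S \<longrightarrow> x s = 0}" (is "?A = ?B")
  proof
    show "?A \<subseteq> ?B"
    proof
      fix x assume "x \<in> ?A"
      then obtain c K where x: "x = finsum ?F c K" and K: "finite K" "\<forall>k\<in>K. c k \<in> part ?F (i, k)"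
        by blast
      have "x = (\<lambda>s. \<Sum>k\<in>K. c k s)"
        unfolding x using K part_free_bigraded by (intro finsum_free_bigraded) blast+
      moreover have "c k s = 0" if "k \<in> K" "s \<notin> ?S" for k s
        using K(2) that by (force simp: free_bigraded_def)
      ultimately show "x \<in> ?B" by simp
    qed
    show "?B \<subseteq> ?A"
    proof
      fix x assume x: "x \<in> ?B"
      \<comment> \<open>All weights occurring in \<open>S\<close> are taken, also those absent from
        dimension \<open>i\<close>; their slices are zero.\<close>
      let ?K = "(snd \<circ> deg) ` S" and ?c = "\<lambda>k s. if deg s = (i, k) then x s else 0"
      have fin: "finite ?K" using assms by simp
      have c: "?c k \<in> part ?F (i, k)" for k
        using x by (auto simp: free_bigraded_def)
      have "finsum ?F ?c ?K = (\<lambda>s. \<Sum>k\<in>?K. ?c k s)"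
        using fin c part_free_bigraded by (intro finsum_free_bigraded) blast+
      also have "\<dots> = x"
      proof
        fix s
        show "(\<Sum>k\<in>?K. ?c k s) = x s"
        proof (cases "s \<in> ?S")
          case True
          then have "(\<Sum>k\<in>?K. ?c k s) = (\<Sum>k\<in>?K. if k = snd (deg s) then x s else 0)"
            by (intro sum.cong) (auto simp: prod_eq_iff)
          also have "\<dots> = x s"
            using True fin by (subst sum.delta) auto
          finally show ?thesis .
        next
          case False
          then have "x s = 0" using x by blast
          then show ?thesis by (simp cong: if_cong)
        qed
      qed
      finally have "x = finsum ?F ?c ?K" by simp
      with fin c show "x \<in> ?A" by blast
    qed
  qed
  moreover have "(\<lambda>(i', k). if i' = i then part ?F (i, k) else {\<zero>\<^bsub>?F\<^esub>}) = part (free_bigraded ?S deg)"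
  proof (rule ext, clarify)
    fix i' k
    show "(if i' = i then part ?F (i, k) else {\<zero>\<^bsub>?F\<^esub>}) = part (free_bigraded ?S deg) (i', k)"
    proof (cases "i' = i")
      case True
      then show ?thesis by (force simp: free_bigraded_def)
    next
      case False
      \<comment> \<open>A nonzero coefficient would belong to a basis element of dimension both
        \<open>i\<close> and \<open>i'\<close>.\<close>
      then have "x = (\<lambda>_. 0)" if "x \<in> part (free_bigraded ?S deg) (i', k)" for x
        using that by (fastforce simp: free_bigraded_def)
      moreover have "(\<lambda>_. 0) \<in> part (free_bigraded ?S deg) (i', k)"
        by (simp add: free_bigraded_def)
      ultimately show ?thesis
        using False by (auto simp: free_bigraded_def)
    qed
  qed
  ultimately show ?thesis
    unfolding dim_component_def by (simp add: free_bigraded_def)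
qed

text \<open>An enumeration \<open>b\<close> of the basis reindexes the coefficients.\<close>

lemma is_bigraded_iso_concentrated:
  assumes "finite S" and deg: "\<And>s. s \<in> S \<Longrightarrow> deg s = d"
  shows "\<exists>T. is_bigraded_iso T (concentrated (card S) d) (free_bigraded S deg)"
proof -
  obtain b where b: "bij_betw b S {..<card S}"
    using ex_bij_betw_finite_nat[OF \<open>finite S\<close>] atLeast0LessThan by auto
  let ?b' = "inv_into S b"
  define T :: "(nat \<Rightarrow> bit) \<Rightarrow> 'a \<Rightarrow> bit" where "T y = (\<lambda>s. if s \<in> S then y (b s) else 0)" for y
  define U :: "('a \<Rightarrow> bit) \<Rightarrow> nat \<Rightarrow> bit" where "U x = (\<lambda>n. if n < card S then x (?b' n) else 0)" for x
  have b1: "b s < card S" "?b' (b s) = s" if "s \<in> S" for s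
    using b that bij_betwE[OF b] by (auto simp: bij_betw_inv_into_left)
  have b2: "?b' n \<in> S" "b (?b' n) = n" if "n < card S" for n
    using b that bij_betwE[OF bij_betw_inv_into[OF b]] by (auto simp: bij_betw_inv_into_right)
  let ?N = "concentrated (card S) d" and ?M = "free_bigraded S deg"
  have UT: "U (T y) = y" if "y \<in> carrier ?N" for y
    using that b2 by (auto simp: U_def T_def concentrated_def free_bigraded_def fun_eq_iff)
  have TU: "T (U x) = x" if "x \<in> carrier ?M" for x
    using that b1 by (auto simp: U_def T_def free_bigraded_def fun_eq_iff)
  have T: "T y \<in> carrier ?M" and U: "U x \<in> carrier ?N" for x y
    by (auto simp: T_def U_def concentrated_def free_bigraded_def)
  have bij: "bij_betw T (carrier ?N) (carrier ?M)"
    by (rule bij_betwI[where g = U]) (use UT TU T U in auto)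
  \<comment> \<open>Since only the bidegree \<open>d\<close> occurs, each part is everything or zero
    on both sides, so compatibility with the grading follows from bijectivity.\<close>
  have partN: "part ?N e = (if e = d then carrier ?N else {\<zero>\<^bsub>?N\<^esub>})" for e
    by (auto simp: concentrated_def free_bigraded_def fun_eq_iff)
  have partM: "part ?M e = (if e = d then carrier ?M else {\<zero>\<^bsub>?M\<^esub>})" for e
  proof (cases "e = d")
    case True
    then show ?thesis
      using deg by (auto simp: free_bigraded_def) (metis zero_neq_one)
  next
    case False
    then have "x = (\<lambda>_. 0)" if "x \<in> part ?M e" for x
      using that deg by (simp add: free_bigraded_def fun_eq_iff) (metis bit_not_one_iff)
    moreover have "(\<lambda>_. 0) \<in> part ?M e" by (simp add: free_bigraded_def)
    ultimately show ?thesis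
      using False by (auto simp: free_bigraded_def)
  qed
  have zero: "T \<zero>\<^bsub>?N\<^esub> = \<zero>\<^bsub>?M\<^esub>"
    by (simp add: T_def concentrated_def free_bigraded_def)
  have "T ` part ?N e = part ?M e" for e
    using bij by (simp add: partN partM zero bij_betw_def)
  then have "is_bigraded_iso T ?N ?M"
    unfolding is_bigraded_iso_def using bij zero
    by (auto simp: T_def concentrated_def free_bigraded_def fun_eq_iff)
  then show ?thesis by blast
qed

section \<open>Horizontal homology with at most one black vertex\<close>

text \<open>The additive structure is that of the factor group \<open>Z / B\<close>. It is needed
  because \<open>uber_diff\<close> is a \<open>finsum\<close> in horizontal homology.\<close>

lemma abelian_monoid_subquotient:
  assumes "comm_group (add_monoid M)" "subgroup Z (add_monoid M)" "subgroup B (add_monoid M)"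
    and "B \<subseteq> Z"
  shows "abelian_monoid (subquotient M Z B)"
proof -
  let ?G = "(add_monoid M)\<lparr>carrier := Z\<rparr>"
  interpret G: comm_group "add_monoid M" by fact
  interpret Z: comm_group ?G
  proof (rule group.group_comm_groupI[OF G.subgroup_imp_group[OF assms(2)]])
    fix x y assume "x \<in> carrier ?G" "y \<in> carrier ?G"
    then show "x \<otimes>\<^bsub>?G\<^esub> y = y \<otimes>\<^bsub>?G\<^esub> x"
      using G.m_comm subgroup.mem_carrier[OF assms(2)] by simp
  qed
  have "subgroup B ?G"
    using assms(2-4) by (intro G.subgroup_incl)
  then interpret Q: comm_group "?G Mod B"
    by (rule Z.abelian_FactGroup)
  have eqs: "carrier (subquotient M Z B) = carrier (?G Mod B)"
    "\<zero>\<^bsub>subquotient M Z B\<^esub> = \<one>\<^bsub>?G Mod B\<^esub>"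
    "c \<oplus>\<^bsub>subquotient M Z B\<^esub> d = c \<otimes>\<^bsub>?G Mod B\<^esub> d" for c d
    by (simp_all add: subquotient_def FactGroup_def A_RCOSETS_def RCOSETS_def r_coset_def
        set_add_def set_mult_def)
  show ?thesis
    by (rule abelian_monoidI; unfold eqs)
      (simp_all only: Q.m_closed Q.one_closed Q.m_assoc Q.l_one, rule Q.m_comm)
qed

text \<open>A simplex containing both \<open>u\<close> and \<sigma> has
  \<open>insert u \<sigma>\<close> as a face. In this form the star condition meets the description
  of the boundaries in \<open>hboundaries_one_black\<close>.\<close>

lemma closed_star_iff:
  assumes "simplicial_complex X" "\<sigma> \<in> X"
  shows "\<sigma> \<in> closed_star X u \<longleftrightarrow> insert u \<sigma> \<in> X"
proof
  assume "\<sigma> \<in> closed_star X u"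
  then obtain \<rho> where "\<rho> \<in> X" "insert u \<sigma> \<subseteq> \<rho>" by (auto simp: closed_star_def)
  then show "insert u \<sigma> \<in> X" using assms(1) unfolding simplicial_complex_def by blast
qed (use assms in \<open>auto simp: closed_star_def\<close>)

lemma hdiff_no_black: "black v m \<epsilon> = {} \<Longrightarrow> hdiff X v m \<epsilon> x = (\<lambda>_. 0)"
  by (simp add: hdiff_def)

text \<open>Only \<open>u\<close> can be removed, so \<tau> arises from
  \<open>insert u \<tau>\<close> alone. The condition \<open>\<tau> \<noteq> {}\<close> reflects
  that the complex is not augmented.\<close>

lemma hdiff_one_black:
  assumes "finite X" and black: "black v m \<epsilon> = {u}"
  shows "hdiff X v m \<epsilon> x =
    (\<lambda>\<tau>. if u \<notin> \<tau> \<and> \<tau> \<noteq> {} \<and> insert u \<tau> \<in> X then x (insert u \<tau>) else 0)"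
proof
  fix \<tau>
  have inner: "(\<Sum>w \<in> {w \<in> \<sigma> \<inter> {u}. \<sigma> - {w} \<noteq> {}}. if \<sigma> - {w} = \<tau> then 1 else 0) =
      (if \<sigma> = insert u \<tau> \<and> u \<notin> \<tau> \<and> \<tau> \<noteq> {} then 1 else 0 :: bit)" for \<sigma>
  proof -
    have "{w \<in> \<sigma> \<inter> {u}. \<sigma> - {w} \<noteq> {}} = (if u \<in> \<sigma> \<and> \<sigma> - {u} \<noteq> {} then {u} else {})"
      by auto
    then show ?thesis by auto
  qed
  have "hdiff X v m \<epsilon> x \<tau> =
      (\<Sum>\<sigma>\<in>X. if \<sigma> = insert u \<tau> then (if u \<notin> \<tau> \<and> \<tau> \<noteq> {} then x \<sigma> else 0) else 0)"
    unfolding hdiff_def black inner by (intro sum.cong) auto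
  also have "\<dots> = (if u \<notin> \<tau> \<and> \<tau> \<noteq> {} \<and> insert u \<tau> \<in> X then x (insert u \<tau>) else 0)"
    using \<open>finite X\<close> by simp
  finally show "hdiff X v m \<epsilon> x \<tau> = \<dots>" .
qed

lemma hboundaries_one_black:
  assumes "finite X" and "black v m \<epsilon> = {u}"
  shows "hboundaries X v m \<epsilon> =
    {y. \<forall>\<tau>. y \<tau> \<noteq> 0 \<longrightarrow> u \<notin> \<tau> \<and> \<tau> \<noteq> {} \<and> insert u \<tau> \<in> X}" (is "?L = ?R")
proof
  show "?L \<subseteq> ?R"
    by (auto simp: hboundaries_def hdiff_one_black[OF assms] split: if_splits)
  show "?R \<subseteq> ?L"
  proof
    fix y assume y: "y \<in> ?R"
    \<comment> \<open>The cone over \<open>y\<close> with apex \<open>u\<close>: every simplex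
      \<tau> of \<open>y\<close> is replaced by \<open>insert u \<tau>\<close>, whose only
      horizontal face is \<tau>.\<close>
    let ?x = "\<lambda>\<sigma>. if \<sigma> \<in> X \<and> u \<in> \<sigma> then y (\<sigma> - {u}) else 0"
    have "hdiff X v m \<epsilon> ?x = y"
      using y by (auto simp: hdiff_one_black[OF assms] fun_eq_iff)
    moreover have "?x \<in> carrier (chains X v m \<epsilon>)"
      by (simp add: chains_def free_bigraded_def)
    ultimately show "y \<in> ?L"
      unfolding hboundaries_def by (intro image_eqI[of _ _ ?x]) (rule sym)
  qed
qed

text \<open>Closure under negation is automatic in characteristic 2.\<close>

lemma subgroup_free_bigradedI:
  assumes "A \<subseteq> carrier (free_bigraded S deg)" "(\<lambda>_. 0) \<in> A"
    and "\<And>x y. x \<in> A \<Longrightarrow> y \<in> A \<Longrightarrow> (\<lambda>s. x s + y s) \<in> A"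
  shows "subgroup A (add_monoid (free_bigraded S deg))"
proof -
  interpret comm_group "add_monoid (free_bigraded S deg)" by (rule comm_group_free_bigraded)
  have "inv\<^bsub>add_monoid (free_bigraded S deg)\<^esub> x = x" if "x \<in> A" for x
    by (rule inv_equality) (use assms(1) that in \<open>auto simp: free_bigraded_def\<close>)
  then show ?thesis
    using assms by (intro subgroupI) (auto simp: free_bigraded_def)
qed

text \<open>These facts let a component of the differential be evaluated on representatives: the sum
  of edge maps is meaningful, the image of a chain is a class, and this class is zero exactly for
  boundaries.\<close>

lemma
  assumes X: "simplicial_complex X" "finite X" and black: "black v m \<epsilon> = {u}"
  shows abelian_monoid_hhomology_one_black: "abelian_monoid (hhomology X v m \<epsilon>)"
    and coset_in_hhomology_one_black: "\<And>x. x \<in> carrier (chains X v m \<epsilon>) \<Longrightarrow>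
      (\<And>\<sigma>. u \<in> \<sigma> \<Longrightarrow> x \<sigma> = 0) \<Longrightarrow>
      hboundaries X v m \<epsilon> +>\<^bsub>chains X v m \<epsilon>\<^esub> x \<in> carrier (hhomology X v m \<epsilon>)"
    and coset_eq_hboundaries_iff: "\<And>x. x \<in> carrier (chains X v m \<epsilon>) \<Longrightarrow>
      hboundaries X v m \<epsilon> +>\<^bsub>chains X v m \<epsilon>\<^esub> x = hboundaries X v m \<epsilon> \<longleftrightarrow> x \<in> hboundaries X v m \<epsilon>"
proof -
  let ?C = "chains X v m \<epsilon>" and ?B = "hboundaries X v m \<epsilon>"
  let ?Z = "a_kernel ?C ?C (hdiff X v m \<epsilon>)"
  note hdiff = hdiff_one_black[OF X(2) black] and B_eq = hboundaries_one_black[OF X(2) black]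
  have Z_eq: "?Z = {x \<in> carrier ?C. hdiff X v m \<epsilon> x = (\<lambda>_. 0)}"
    by (simp add: a_kernel_def kernel_def chains_def free_bigraded_def)
  have faces: "\<tau> \<in> X" if "\<tau> \<noteq> {}" "insert u \<tau> \<in> X" for \<tau>
    using X(1) that subset_insertI[of \<tau> u] unfolding simplicial_complex_def by metis
  have B: "subgroup ?B (add_monoid ?C)"
    unfolding chains_def
  proof (rule subgroup_free_bigradedI)
    show "?B \<subseteq> carrier (free_bigraded X (\<lambda>\<sigma>. (card \<sigma> - 1, card (\<sigma> - black v m \<epsilon>))))"
      using faces unfolding B_eq free_bigraded_def by auto (metis bit_not_zero_iff)
  qed (auto simp: B_eq)
  have Z: "subgroup ?Z (add_monoid ?C)"
    unfolding Z_eq unfolding chains_def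
  proof (rule subgroup_free_bigradedI, goal_cases)
    case (3 x y)
    then have "hdiff X v m \<epsilon> x = (\<lambda>_. 0)" "hdiff X v m \<epsilon> y = (\<lambda>_. 0)" by auto
    moreover have "hdiff X v m \<epsilon> (\<lambda>s. x s + y s) = (\<lambda>\<tau>. hdiff X v m \<epsilon> x \<tau> + hdiff X v m \<epsilon> y \<tau>)"
      unfolding hdiff by (rule ext) (simp del: add_bit_eq_xor)
    ultimately have "hdiff X v m \<epsilon> (\<lambda>s. x s + y s) = (\<lambda>_. 0)" by simp
    then show ?case using 3 by (simp add: free_bigraded_def)
  qed (auto simp: free_bigraded_def hdiff)
  \<comment> \<open>Simplices of a boundary avoid \<open>u\<close>, the only vertex that the
    differential could remove.\<close>
  have "?B \<subseteq> ?Z"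
    using subgroup.subset[OF B] by (auto simp: B_eq Z_eq hdiff fun_eq_iff)
  then show "abelian_monoid (hhomology X v m \<epsilon>)"
    unfolding hhomology_def using B Z comm_group_free_bigraded
    by (intro abelian_monoid_subquotient) (simp_all add: chains_def)
  show "?B +>\<^bsub>?C\<^esub> x \<in> carrier (hhomology X v m \<epsilon>)"
    if "x \<in> carrier ?C" "\<And>\<sigma>. u \<in> \<sigma> \<Longrightarrow> x \<sigma> = 0" for x
  proof -
    have "x \<in> ?Z" using that by (auto simp: Z_eq hdiff fun_eq_iff)
    then show ?thesis
      by (auto simp: hhomology_def subquotient_def A_RCOSETS_def RCOSETS_def a_r_coset_def
          r_coset_def)
  qed
  interpret C: comm_group "add_monoid ?C"
    unfolding chains_def by (rule comm_group_free_bigraded)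
  show "?B +>\<^bsub>?C\<^esub> x = ?B \<longleftrightarrow> x \<in> ?B" if "x \<in> carrier ?C" for x
    using that B C.coset_join1[of ?B x] C.coset_join2[of x ?B]
    by (auto simp: a_r_coset_def)
qed

section \<open>The differential from degree 0 to degree 1\<close>

text \<open>The restriction makes it \<open>undefined\<close> outside \<open>{1..m}\<close>, as
  membership in \<open>colourings\<close> demands.\<close>

definition all_white :: "nat \<Rightarrow> colouring" where
  "all_white m = (\<lambda>i\<in>{1..m}. 0)"

lemma colourings_0: "colourings m 0 = {all_white m}"
  by (auto simp: colourings_def all_white_def PiE_iff extensional_def fun_eq_iff)

lemma black_indices_one_black: "i \<in> {1..m} \<Longrightarrow> {k\<in>{1..m}. ((all_white m)(i := 1)) k = 1} = {i}"
  by (auto simp: all_white_def)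

lemma colourings_1: "colourings m (Suc 0) = (\<lambda>i. (all_white m)(i := 1)) ` {1..m}"
proof safe
  fix \<epsilon> assume "\<epsilon> \<in> colourings m (Suc 0)"
  then obtain i where ext: "\<epsilon> \<in> {1..m} \<rightarrow>\<^sub>E UNIV" and i: "{i\<in>{1..m}. \<epsilon> i = 1} = {i}"
    by (auto simp: colourings_def card_1_singleton_iff)
  then have "\<epsilon> = (all_white m)(i := 1)"
    by (auto simp: all_white_def fun_eq_iff PiE_iff extensional_def)
  moreover have "i \<in> {1..m}" using i by blast
  ultimately show "\<epsilon> \<in> (\<lambda>i. (all_white m)(i := 1)) ` {1..m}" by blast
next
  fix i assume i: "i \<in> {1..m}"
  then have "(all_white m)(i := 1) \<in> {1..m} \<rightarrow>\<^sub>E UNIV"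
    by (auto simp: all_white_def PiE_iff extensional_def)
  then show "(all_white m)(i := 1) \<in> colourings m (Suc 0)"
    unfolding colourings_def mem_Collect_eq black_indices_one_black[OF i] by simp
qed

lemma black_all_white: "black v m (all_white m) = {}"
  by (auto simp: black_def all_white_def)

lemma black_one_black: "i \<in> {1..m} \<Longrightarrow> black v m ((all_white m)(i := 1)) = {v i}"
  unfolding black_def by (simp only: black_indices_one_black) simp

text \<open>At the colouring with only \<open>v i\<close> black, the differential is a single edge
  map, and its value is zero iff the truncated chain is a boundary. For simplices avoiding
  \<open>v i\<close> this is the star condition; those containing \<open>v i\<close> are dropped by
  the truncation and lie in the star anyway.\<close>

lemma uber_diff_0_eq_zero_iff:
  assumes X: "simplicial_complex X" "finite X"
    and x: "x \<in> carrier (chains X v m (all_white m))"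
  shows "uber_diff X v m 0 (\<lambda>\<epsilon>\<in>{all_white m}. {x}) = \<zero>\<^bsub>uber_chains X v m (Suc 0)\<^esub> \<longleftrightarrow>
    (\<forall>\<sigma>. \<sigma> \<notin> X \<inter> (\<Inter>i\<in>{1..m}. closed_star X (v i)) \<longrightarrow> x \<sigma> = 0)"
proof -
  let ?e = "\<lambda>i. (all_white m)(i := 1)" and ?x = "\<lambda>i \<sigma>. if v i \<in> \<sigma> then 0 else x \<sigma>"
  let ?f = "\<lambda>\<epsilon>\<in>{all_white m}. {x}"
  have x0: "\<sigma> \<in> X" if "x \<sigma> \<noteq> 0" for \<sigma>
    using x that by (auto simp: chains_def free_bigraded_def)
  have ne: "\<sigma> \<noteq> {}" if "\<sigma> \<in> X" for \<sigma>
    using X(1) that by (auto simp: simplicial_complex_def)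
  have diff: "(\<Oplus>\<^bsub>hhomology X v m (?e i)\<^esub> k \<in> {k\<in>{1..m}. ?e i k = 1}.
        edge_map X v m ((?e i)(k := 0)) k (?f ((?e i)(k := 0)))) =
      hboundaries X v m (?e i) +>\<^bsub>chains X v m (?e i)\<^esub> ?x i"
    and xi: "?x i \<in> carrier (chains X v m (?e i))" if i: "i \<in> {1..m}" for i
  proof -
    note black = black_one_black[OF i, of v]
    interpret abelian_monoid "hhomology X v m (?e i)"
      by (rule abelian_monoid_hhomology_one_black[OF X black])
    show xi: "?x i \<in> carrier (chains X v m (?e i))"
      using x by (auto simp: chains_def free_bigraded_def)
    \<comment> \<open>The range of \<open>i\<close> matters: outside \<open>{1..m}\<close> the value
      to be restored would be \<open>undefined\<close>.\<close>
    have e0: "(?e i)(i := 0) = all_white m"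
      using i by (auto simp: all_white_def fun_eq_iff)
    have edge: "edge_map X v m ((?e i)(i := 0)) i (?f ((?e i)(i := 0))) =
        hboundaries X v m (?e i) +>\<^bsub>chains X v m (?e i)\<^esub> ?x i"
      \<comment> \<open>The class is the singleton \<open>{x}\<close>, so the union in
        \<open>edge_map\<close> has one member.\<close>
      unfolding e0 by (simp add: edge_map_def)
    have "\<dots> \<in> carrier (hhomology X v m (?e i))"
      by (rule coset_in_hhomology_one_black[OF X black xi]) auto
    then show "(\<Oplus>\<^bsub>hhomology X v m (?e i)\<^esub> k \<in> {k\<in>{1..m}. ?e i k = 1}.
        edge_map X v m ((?e i)(k := 0)) k (?f ((?e i)(k := 0)))) =
      hboundaries X v m (?e i) +>\<^bsub>chains X v m (?e i)\<^esub> ?x i"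
      unfolding black_indices_one_black[OF i] by (subst finsum_insert) (simp_all only: edge, auto)
  qed
  have zero: "\<zero>\<^bsub>hhomology X v m \<epsilon>\<^esub> = hboundaries X v m \<epsilon>" for \<epsilon>
    by (simp add: hhomology_def subquotient_def)
  have "uber_diff X v m 0 ?f = \<zero>\<^bsub>uber_chains X v m (Suc 0)\<^esub> \<longleftrightarrow>
      (\<forall>i\<in>{1..m}. hboundaries X v m (?e i) +>\<^bsub>chains X v m (?e i)\<^esub> ?x i = hboundaries X v m (?e i))"
  proof -
    have restrict_eq: "restrict g A = restrict h A \<longleftrightarrow> (\<forall>a\<in>A. g a = h a)"
      for g h :: "colouring \<Rightarrow> ('a set \<Rightarrow> bit) set" and A
      by (metis restrict_apply' restrict_ext)
    have z: "\<zero>\<^bsub>uber_chains X v m (Suc 0)\<^esub> =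
        (\<lambda>\<epsilon>\<in>colourings m (Suc 0). hboundaries X v m \<epsilon>)"
      by (simp add: uber_chains_def direct_sum_def zero)
    show ?thesis
      unfolding uber_diff_def z restrict_eq colourings_1 ball_simps
      by (rule ball_cong[OF refl]) (simp only: diff)
  qed
  also have "\<dots> \<longleftrightarrow> (\<forall>i\<in>{1..m}. ?x i \<in> hboundaries X v m (?e i))"
    using coset_eq_hboundaries_iff[OF X black_one_black xi] by blast
  also have "\<dots> \<longleftrightarrow> (\<forall>i\<in>{1..m}. \<forall>\<sigma>. x \<sigma> \<noteq> 0 \<longrightarrow> insert (v i) \<sigma> \<in> X)"
  proof (rule ball_cong[OF refl])
    fix i assume "i \<in> {1..m}"
    from hboundaries_one_black[OF X(2) black_one_black[OF this, of v]]
    have "?x i \<in> hboundaries X v m (?e i) \<longleftrightarrow>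
        (\<forall>\<sigma>. ?x i \<sigma> \<noteq> 0 \<longrightarrow> v i \<notin> \<sigma> \<and> \<sigma> \<noteq> {} \<and> insert (v i) \<sigma> \<in> X)"
      by (simp only: mem_Collect_eq)
    also have "\<dots> \<longleftrightarrow> (\<forall>\<sigma>. x \<sigma> \<noteq> 0 \<longrightarrow> insert (v i) \<sigma> \<in> X)"
    proof (rule iff_allI)
      fix \<sigma>
      show "(?x i \<sigma> \<noteq> 0 \<longrightarrow> v i \<notin> \<sigma> \<and> \<sigma> \<noteq> {} \<and> insert (v i) \<sigma> \<in> X) \<longleftrightarrow>
          (x \<sigma> \<noteq> 0 \<longrightarrow> insert (v i) \<sigma> \<in> X)"
        using x0[of \<sigma>] ne[of \<sigma>] by (cases "v i \<in> \<sigma>") (auto simp: insert_absorb)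
    qed
    finally show "?x i \<in> hboundaries X v m (?e i) \<longleftrightarrow> \<dots>" .
  qed
  also have "\<dots> \<longleftrightarrow> (\<forall>\<sigma>. \<sigma> \<notin> X \<inter> (\<Inter>i\<in>{1..m}. closed_star X (v i)) \<longrightarrow> x \<sigma> = 0)"
  proof -
    have "\<sigma> \<in> X \<inter> (\<Inter>i\<in>{1..m}. closed_star X (v i)) \<longleftrightarrow>
        \<sigma> \<in> X \<and> (\<forall>i\<in>{1..m}. insert (v i) \<sigma> \<in> X)" for \<sigma>
      using closed_star_iff[OF X(1), of \<sigma>] by auto
    then show ?thesis using x0 by blast
  qed
  finally show ?thesis .
qed

section \<open>Uberhomology in degree 0\<close>

text \<open>Chains are identified with classes for the all-white colouring, then with families over
  that single colouring. The kernel of the differential corresponds to the chains supported on the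
  intersection of stars, and the final quotient is by zero.\<close>

lemma is_bigraded_iso_uber_homology_0:
  assumes X: "simplicial_complex X" "finite X"
  shows "\<exists>T. is_bigraded_iso T
    (free_bigraded (X \<inter> (\<Inter>i\<in>{1..m}. closed_star X (v i))) (\<lambda>\<sigma>. (card \<sigma> - 1, card \<sigma>)))
    (uber_homology X v m 0)"
proof -
  let ?C = "chains X v m (all_white m)" and ?H = "hhomology X v m" and ?U = "uber_chains X v m 0"
  \<comment> \<open>For \<open>m = 0\<close> the indexed intersection is \<open>UNIV\<close>;
    intersecting with \<open>X\<close> keeps only simplices.\<close>
  let ?S = "X \<inter> (\<Inter>i\<in>{1..m}. closed_star X (v i))" and ?d = "\<lambda>\<sigma>::'a set. (card \<sigma> - 1, card \<sigma>)"
  let ?K = "{x. \<forall>\<sigma>. \<sigma> \<notin> ?S \<longrightarrow> x \<sigma> = (0::bit)}"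
  have C: "?C = free_bigraded X ?d"
    by (simp add: chains_def black_all_white)
  have C_monoid: "abelian_monoid ?C"
    unfolding C by (rule abelian_monoid_free_bigraded)
  have H: "?H (all_white m) = subquotient ?C (carrier ?C) {\<zero>\<^bsub>?C\<^esub>}"
  proof -
    have "hdiff X v m (all_white m) = (\<lambda>_ _. 0)"
      by (rule ext) (rule hdiff_no_black[OF black_all_white])
    then have "hboundaries X v m (all_white m) = {\<zero>\<^bsub>?C\<^esub>}"
        "a_kernel ?C ?C (hdiff X v m (all_white m)) = carrier ?C"
      by (auto simp: hboundaries_def a_kernel_def kernel_def C free_bigraded_def)
    then show ?thesis by (simp add: hhomology_def)
  qed
  have "sub_bigraded ?C (carrier ?C) = ?C"
    by (auto simp: sub_bigraded_def C free_bigraded_def)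
  then have "is_bigraded_iso (\<lambda>x. {x}) ?C (?H (all_white m))"
    unfolding H using is_bigraded_iso_subquotient_zero[OF C_monoid subset_refl]
    by (simp add: C free_bigraded_def)
  then have "is_bigraded_iso ((\<lambda>c. \<lambda>\<epsilon>\<in>{all_white m}. c) \<circ> (\<lambda>x. {x})) ?C ?U"
    unfolding uber_chains_def colourings_0
    by (rule is_bigraded_iso_comp) (rule is_bigraded_iso_direct_sum_singleton)
  then have T: "is_bigraded_iso (\<lambda>x. \<lambda>\<epsilon>\<in>{all_white m}. {x}) ?C ?U" (is "is_bigraded_iso ?T _ _")
    by (simp add: o_def)
  have K: "?K \<subseteq> carrier ?C"
    by (auto simp: C free_bigraded_def)
  have carrier_U: "carrier ?U = ?T ` carrier ?C"
    using is_bigraded_isoD(1)[OF T] by (simp add: bij_betw_def)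
  have ker: "a_kernel ?U (uber_chains X v m (Suc 0)) (uber_diff X v m 0) = ?T ` ?K"
    using K uber_diff_0_eq_zero_iff[OF X, of _ v m]
    by (auto simp: a_kernel_def kernel_def carrier_U)
  have "is_bigraded_iso ?T (sub_bigraded ?C ?K) (sub_bigraded ?U (?T ` ?K))"
    using part_free_bigraded by (intro is_bigraded_iso_sub_bigraded[OF T K]) (simp add: C)
  moreover have "sub_bigraded ?C ?K = free_bigraded ?S ?d"
    unfolding C by (rule sub_bigraded_free_bigraded) auto
  moreover have "is_bigraded_iso (\<lambda>x. {x}) (sub_bigraded ?U (?T ` ?K)) (uber_homology X v m 0)"
  proof -
    \<comment> \<open>Closure under scalars in the direct sum is carried over from the chains along
      \<open>?T\<close>.\<close>
    have "a \<odot>\<^bsub>?U\<^esub> ?T x \<in> carrier ?U" if "x \<in> ?K" for a x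
      using that K is_bigraded_isoD(4)[OF T, of x a] is_bigraded_isoD(6)[OF T, of "a \<odot>\<^bsub>?C\<^esub> x"]
      by (auto simp: C free_bigraded_def)
    then have "is_bigraded_iso (\<lambda>x. {x}) (sub_bigraded ?U (?T ` ?K))
        (subquotient ?U (?T ` ?K) {\<zero>\<^bsub>?U\<^esub>})"
      using image_mono[OF K, of ?T] unfolding carrier_U[symmetric]
      by (intro is_bigraded_iso_subquotient_zero abelian_monoid_transfer[OF C_monoid T]) blast+
    then show ?thesis
      unfolding uber_homology_def ker uber_boundaries_def by simp
  qed
  ultimately show ?thesis
    by (metis (no_types, lifting) is_bigraded_iso_comp)
qed

theorem theorem7p1:
  fixes X :: "'a set set" and v :: "nat \<Rightarrow> 'a" and m j :: nat
  assumes "simplicial_complex X" and "finite X" and "connected_complex X"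
    and "bij_betw v {1..m} (\<Union>X)"
  shows "bigraded_iso
    (dim_component (uber_homology X v m 0) j)
    (concentrated (card {\<sigma> \<in> X \<inter> (\<Inter>i\<in>{1..m}. closed_star X (v i)). card \<sigma> = j + 1}) (j, j + 1))"
proof -
  let ?S = "X \<inter> (\<Inter>i\<in>{1..m}. closed_star X (v i))" and ?d = "\<lambda>\<sigma>::'a set. (card \<sigma> - 1, card \<sigma>)"
  let ?Sj = "{\<sigma> \<in> ?S. card \<sigma> = j + 1}"
  have fin: "finite ?S" using assms(2) by simp
  obtain T where T: "is_bigraded_iso T (free_bigraded ?S ?d) (uber_homology X v m 0)"
    using is_bigraded_iso_uber_homology_0[OF assms(1,2), of v m] by (elim exE)
  \<comment> \<open>The subtraction in \<open>card \<sigma> - 1\<close> is truncated, so the case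
    \<open>j = 0\<close> relies on simplices being nonempty.\<close>
  have "fst (?d \<sigma>) = j \<longleftrightarrow> card \<sigma> = j + 1" if "\<sigma> \<in> ?S" for \<sigma>
  proof -
    have "card \<sigma> > 0"
      using assms(1) that by (simp add: simplicial_complex_def card_gt_0_iff)
    then show ?thesis by auto
  qed
  then have Sj: "{\<sigma>\<in>?S. fst (?d \<sigma>) = j} = ?Sj"
    by (rule Collect_cong[OF conj_cong[OF refl]])
  have comp: "is_bigraded_iso T (free_bigraded ?Sj ?d) (dim_component (uber_homology X v m 0) j)"
    using is_bigraded_iso_dim_component[OF abelian_monoid_free_bigraded T part_free_bigraded, of j]
    unfolding dim_component_free_bigraded[OF fin] Sj .
  have finite_Sj: "finite ?Sj" by (rule finite_subset[OF _ fin]) blast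
  have "\<exists>U. is_bigraded_iso U (concentrated (card ?Sj) (j, j + 1)) (free_bigraded ?Sj ?d)"
    by (rule is_bigraded_iso_concentrated[OF finite_Sj]) simp
  then obtain U where
    "is_bigraded_iso U (concentrated (card ?Sj) (j, j + 1)) (free_bigraded ?Sj ?d)"
    by (elim exE)
  \<comment> \<open>The composite leads from the concentrated space to homology; its inverse is the
    required isomorphism.\<close>
  from is_bigraded_iso_comp[OF this comp] show ?thesis
    by (rule bigraded_iso_inverse) (auto simp: concentrated_def free_bigraded_def)
qed

end
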